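(* There exists a critical set of size $29$ in the Latin square $L(9)$.
   Context: A Latin square $L$ of order $N$ is an $N\times N$ array, with rows and columns indexed by $\{0,\dots,N-1\}$, such that each row and each column contains each of the $N$ elements $0,\dots,N-1$ exactly once. It is identified with the set of its entries $(i,j;k)$, meaning that the cell in row $i$ and column $j$ contains $k$. A subset $C\subseteq L$ is uniquely completable (to $L$) if $L$ is the only Latin square of order $N$ (on the same rows, columns and elements) that contains $C$. A critical set of $L$ (or in $L$) is a subset $C\subseteq L$ that is uniquely completable to $L$ and such that no proper subset of $C$ is uniquely completable to $L$. Its size is its number of entries. $L(9)$ is the Latin square of order $9$ given by the Cayley table of the elementary abelian 3-group $(\mathbb{Z}/3)^2$; explicitly, identify each integer $3a+b$ with $a,b\in\{0,1,2\}$ with $(a,b)\in(\mathbb{Z}/3)^2$; the entry in row $3a+b$ and column $3c+d$ is $3e+f$, where $e,f\in\{0,1,2\}$, $e\equiv a+c$ and $f\equiv b+d \pmod 3$. *)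

theory Defs
  imports Main
begin

text \<open>An array is represented by its set of entries: \<open>(i, j, k)\<close> means that the cell in row \<open>i\<close>
  and column \<open>j\<close> contains \<open>k\<close>. The second conjunct says that such a set is an array (one element
  in every cell).\<close>

definition latin_square :: "nat \<Rightarrow> (nat \<times> nat \<times> nat) set \<Rightarrow> bool" where
  "latin_square N L \<longleftrightarrow>
     L \<subseteq> {..<N} \<times> {..<N} \<times> {..<N} \<and>
     (\<forall>i<N. \<forall>j<N. \<exists>!k. (i, j, k) \<in> L) \<and>
     (\<forall>i<N. \<forall>k<N. \<exists>!j. (i, j, k) \<in> L) \<and>
     (\<forall>j<N. \<forall>k<N. \<exists>!i. (i, j, k) \<in> L)"

definition uniquely_completable ::
  "nat \<Rightarrow> (nat \<times> nat \<times> nat) set \<Rightarrow> (nat \<times> nat \<times> nat) set \<Rightarrow> bool" where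
  "uniquely_completable N L C \<longleftrightarrow>
     latin_square N L \<and> C \<subseteq> L \<and> (\<forall>M. latin_square N M \<and> C \<subseteq> M \<longrightarrow> M = L)"

definition critical_set ::
  "nat \<Rightarrow> (nat \<times> nat \<times> nat) set \<Rightarrow> (nat \<times> nat \<times> nat) set \<Rightarrow> bool" where
  "critical_set N L C \<longleftrightarrow>
     uniquely_completable N L C \<and> (\<forall>D. D \<subset> C \<longrightarrow> \<not> uniquely_completable N L D)"

definition L9 :: "(nat \<times> nat \<times> nat) set" where
  "L9 = {(3 * a + b, 3 * c + d, 3 * ((a + c) mod 3) + (b + d) mod 3) | a b c d.
           a < 3 \<and> b < 3 \<and> c < 3 \<and> d < 3}"

end

theory Submission
  imports Defs "HOL-Combinatorics.Transposition"
begin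

text \<open>The critical set is the partial array

    \<^verbatim>\<open>
    . 1 . . . 5 . . .
    . . . 4 . 3 7 . .
    . 0 1 5 . . . 6 .
    3 . 5 6 . . . 1 .
    . 5 . 7 8 . . . .
    5 . . . . . 2 0 .
    . 7 . . 1 2 3 . .
    . . 6 . 2 . 4 . 3
    . . . . . . . 3 4
    \<close>

  It completes uniquely because a single kind of inference, used 52 times, fills it: a symbol has
  to occur somewhere in each column, and if every row but one either has that cell of the column
  occupied or already contains the symbol, the remaining row must have it (\<open>forced_entry\<close>). The list
  \<open>forcing_order\<close> is an order in which this inference reaches all the empty cells.

  No entry can be dropped, for the following reason. If rows \<open>r\<close> and \<open>s\<close> of the group table are
  restricted to the columns of a coset \<open>c + \<langle>s - r\<rangle>\<close>, both rows show the same three symbols there,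
  namely the coset \<open>r + c + \<langle>s - r\<rangle>\<close>. Exchanging these two segments therefore gives another
  Latin square (\<open>latin_square_row_switch\<close>), which differs from \<open>L9\<close> in these six cells only. For each
  of the 29 entries, lying say in cell \<open>(r, c)\<close>, there is a row \<open>s\<close> such that this entry is the only
  one of the partial array among the six cells; so the new square contains the 28 others
  (\<open>other_completion\<close>).

  The two finite verifications, that the order of inferences is sound and that each group of six
  cells meets the array once, are carried out by rewriting with the defining equations.\<close>

section \<open>Forcing and switching in Latin squares\<close>

lemma latin_squareD:
  assumes "latin_square N L"
  shows latin_square_box: "(i, j, k) \<in> L \<Longrightarrow> i < N \<and> j < N \<and> k < N"
    and latin_square_cell: "i < N \<Longrightarrow> j < N \<Longrightarrow> \<exists>!k. (i, j, k) \<in> L"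
    and latin_square_row: "i < N \<Longrightarrow> k < N \<Longrightarrow> \<exists>!j. (i, j, k) \<in> L"
    and latin_square_col: "j < N \<Longrightarrow> k < N \<Longrightarrow> \<exists>!i. (i, j, k) \<in> L"
  using assms by (auto simp: latin_square_def)

text \<open>Columns are the only lines along which entries are forced below: the symbol \<open>k\<close> must occur in
  column \<open>j\<close>, and every row other than \<open>i\<close> is excluded by an entry in the same cell or by an
  occurrence of \<open>k\<close> elsewhere in that row.\<close>

lemma forced_entry:
  assumes M: "latin_square N M" and jk: "j < N" "k < N"
    and excl: "\<And>x. x < N \<Longrightarrow> x \<noteq> i \<Longrightarrow>
      (\<exists>k'. k' \<noteq> k \<and> (x, j, k') \<in> M) \<or> (\<exists>j'. j' \<noteq> j \<and> (x, j', k) \<in> M)"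
  shows "(i, j, k) \<in> M"
proof -
  obtain x where x: "(x, j, k) \<in> M"
    using latin_square_col[OF M jk] by (elim ex1E)
  then have "x < N"
    using latin_square_box[OF M] by simp
  have "k' = k" if "(x, j, k') \<in> M" for k'
    using latin_square_cell[OF M \<open>x < N\<close> jk(1)] x that by (elim ex1E) metis
  moreover have "j' = j" if "(x, j', k) \<in> M" for j'
    using latin_square_row[OF M \<open>x < N\<close> jk(2)] x that by (elim ex1E) metis
  ultimately have "x = i"
    using excl[OF \<open>x < N\<close>] by metis
  with x show ?thesis by simp
qed

lemma latin_square_subset_eq:
  assumes L: "latin_square N L" and M: "latin_square N M" and sub: "L \<subseteq> M"
  shows "M = L"
proof (rule equalityI[OF _ sub], rule subsetI)
  fix t assume t: "t \<in> M"
  obtain i j k where ijk: "t = (i, j, k)" by (cases t)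
  have ij: "i < N" "j < N"
    using latin_square_box[OF M] t ijk by auto
  obtain k' where k': "(i, j, k') \<in> L"
    using latin_square_cell[OF L ij] by (elim ex1E)
  moreover have "k' = k"
    using latin_square_cell[OF M ij] subsetD[OF sub k'] t ijk by (elim ex1E) metis
  ultimately show "t \<in> L" using ijk by simp
qed

definition row_switch ::
  "nat \<Rightarrow> nat \<Rightarrow> nat set \<Rightarrow> (nat \<times> nat \<times> nat) set \<Rightarrow> (nat \<times> nat \<times> nat) set" where
  "row_switch r s S L = {(i, j, k). (if j \<in> S then transpose r s i else i, j, k) \<in> L}"

text \<open>The switch permutes the entries within each column, so columns are not affected. A symbol
  occurs in row \<open>r\<close> inside \<open>S\<close> iff it does so in row \<open>s\<close>, so it leaves a row together with the
  segment exactly when it returns with the other segment.\<close>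

lemma latin_square_row_switch:
  assumes L: "latin_square N L" and rs: "r < N" "s < N"
    and same: "\<And>k. (\<exists>j\<in>S. (r, j, k) \<in> L) \<longleftrightarrow> (\<exists>j\<in>S. (s, j, k) \<in> L)"
  shows "latin_square N (row_switch r s S L)"
proof -
  note box = latin_square_box[OF L] and cell = latin_square_cell[OF L]
    and row = latin_square_row[OF L] and col = latin_square_col[OF L]
  have tr: "transpose r s i < N \<longleftrightarrow> i < N" for i
    using rs by (simp add: transpose_def)
  let ?M = "row_switch r s S L"
  have mem: "(i, j, k) \<in> ?M \<longleftrightarrow> (if j \<in> S then transpose r s i else i, j, k) \<in> L" for i j k
    by (simp add: row_switch_def)
  have "?M \<subseteq> {..<N} \<times> {..<N} \<times> {..<N}"
  proof
    fix t assume t: "t \<in> ?M"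
    obtain i j k where ijk: "t = (i, j, k)" by (cases t)
    show "t \<in> {..<N} \<times> {..<N} \<times> {..<N}"
      using t box[of "if j \<in> S then transpose r s i else i" j k] tr[of i]
      by (simp add: ijk mem split: if_splits)
  qed
  moreover have "\<exists>!k. (i, j, k) \<in> ?M" if "i < N" "j < N" for i j
    unfolding mem using cell[of "if j \<in> S then transpose r s i else i" j] that tr[of i]
    by (simp split: if_splits)
  moreover have "\<exists>!i. (i, j, k) \<in> ?M" if jk: "j < N" "k < N" for j k
  proof -
    show ?thesis
    proof (cases "j \<in> S")
      case True
      obtain i where i: "(i, j, k) \<in> L" "\<And>i'. (i', j, k) \<in> L \<Longrightarrow> i' = i"
        using col[OF jk] by (elim ex1E) metis
      have "i' = transpose r s i" if "(transpose r s i', j, k) \<in> L" for i'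
        using i(2)[OF that] by (metis transpose_involutory)
      with True i(1) show ?thesis
        by (intro ex1I[of _ "transpose r s i"]) (simp_all add: mem)
    next
      case False
      with col[OF jk] show ?thesis by (simp add: mem)
    qed
  qed
  moreover have "\<exists>!j. (i, j, k) \<in> ?M" if ik: "i < N" "k < N" for i k
  proof -
    let ?i = "transpose r s i"
    obtain j where j: "(i, j, k) \<in> L" "\<And>j'. (i, j', k) \<in> L \<Longrightarrow> j' = j"
      using row[OF ik] by (elim ex1E) metis
    have "?i < N" using ik tr by simp
    obtain j2 where j2: "(?i, j2, k) \<in> L" "\<And>j'. (?i, j', k) \<in> L \<Longrightarrow> j' = j2"
      using row[OF \<open>?i < N\<close> ik(2)] by (elim ex1E) metis
    have seg: "(\<exists>y\<in>S. (i, y, k) \<in> L) \<longleftrightarrow> j \<in> S" "(\<exists>y\<in>S. (?i, y, k) \<in> L) \<longleftrightarrow> j2 \<in> S"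
      using j j2 by metis+
    \<comment> \<open>the symbol lies in both of the switched segments or in neither of them\<close>
    have same_side: "j \<in> S \<longleftrightarrow> j2 \<in> S"
      using same[of k] unfolding seg[symmetric] by (simp add: transpose_def)
    show ?thesis
    proof (rule ex1I[of _ "if j \<in> S then j2 else j"])
      show "(i, if j \<in> S then j2 else j, k) \<in> ?M"
        using j(1) j2(1) same_side by (simp add: mem)
      fix y assume "(i, y, k) \<in> ?M"
      then show "y = (if j \<in> S then j2 else j)"
        using j(2)[of y] j2(2)[of y] same_side by (cases "y \<in> S") (auto simp: mem)
    qed
  qed
  ultimately show ?thesis
    by (simp add: latin_square_def)
qed

text \<open>Subsets that omit a single entry suffice, since any completion of a set also completes its
  subsets.\<close>

lemma critical_setI:
  assumes uc: "uniquely_completable N L C"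
    and other: "\<And>x. x \<in> C \<Longrightarrow> \<exists>M. latin_square N M \<and> C - {x} \<subseteq> M \<and> M \<noteq> L"
  shows "critical_set N L C"
  unfolding critical_set_def
proof (intro conjI uc allI impI)
  fix D assume "D \<subset> C"
  then obtain x where "x \<in> C" "D \<subseteq> C - {x}" by blast
  then show "\<not> uniquely_completable N L D"
    using other[of x] unfolding uniquely_completable_def by blast
qed

section \<open>The group table\<close>

text \<open>Addition and subtraction of \<open>(\<int>/3)\<^sup>2\<close> in the encoding \<open>3 * a + b\<close> of \<open>(a, b)\<close>; as \<open>-y = y + y\<close> in
  a group of exponent 3, subtraction is expressed through addition.\<close>

definition plus9 :: "nat \<Rightarrow> nat \<Rightarrow> nat" where
  "plus9 x y = 3 * ((x div 3 + y div 3) mod 3) + (x + y) mod 3"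

definition minus9 :: "nat \<Rightarrow> nat \<Rightarrow> nat" where
  "minus9 x y = plus9 x (plus9 y y)"

definition entry :: "nat \<times> nat \<Rightarrow> nat \<times> nat \<times> nat" where
  "entry = (\<lambda>(i, j). (i, j, plus9 i j))"

lemma plus9_less: "plus9 x y < 9"
proof -
  have "(x div 3 + y div 3) mod 3 < 3" "(x + y) mod 3 < 3" by simp_all
  then show ?thesis unfolding plus9_def by linarith
qed

lemma minus9_less: "minus9 x y < 9"
  by (simp add: minus9_def plus9_less)

lemma plus9_commute: "plus9 x y = plus9 y x"
  by (simp add: plus9_def add.commute)

lemma plus9_eq_iff:
  assumes "x < 9" "y < 9" "z < 9"
  shows "plus9 x y = z \<longleftrightarrow> y = minus9 z x"
proof -
  have "list_all (\<lambda>x. list_all (\<lambda>y.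
      minus9 (plus9 x y) x = y \<and> plus9 x (minus9 y x) = y) [0..<9]) [0..<9]"
    by code_simp
  then have "minus9 (plus9 x y) x = y" "plus9 x (minus9 z x) = z"
    using assms by (simp_all only: list_all_iff set_upt) auto
  then show ?thesis by metis
qed

lemma L9_iff: "(i, j, k) \<in> L9 \<longleftrightarrow> i < 9 \<and> j < 9 \<and> k = plus9 i j"
proof
  assume "(i, j, k) \<in> L9"
  then obtain a b c d where "a < 3" "b < 3" "c < 3" "d < 3"
    "i = 3 * a + b" "j = 3 * c + d" "k = 3 * ((a + c) mod 3) + (b + d) mod 3"
    unfolding L9_def by blast
  moreover have "(3 * a + b + (3 * c + d)) mod 3 = (b + d) mod 3"
    using mod_mult_self4[of 3 "a + c" "b + d"] by (simp add: algebra_simps)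
  ultimately show "i < 9 \<and> j < 9 \<and> k = plus9 i j"
    by (simp add: plus9_def)
next
  assume ijk: "i < 9 \<and> j < 9 \<and> k = plus9 i j"
  have "(i, j, k) = (3 * (i div 3) + i mod 3, 3 * (j div 3) + j mod 3,
      3 * ((i div 3 + j div 3) mod 3) + (i mod 3 + j mod 3) mod 3)"
    using ijk by (simp add: plus9_def mod_add_eq)
  moreover have "i div 3 < 3" "i mod 3 < 3" "j div 3 < 3" "j mod 3 < 3"
    using ijk by (simp_all add: less_mult_imp_div_less)
  ultimately show "(i, j, k) \<in> L9"
    unfolding L9_def by blast
qed

lemma latin_square_L9: "latin_square 9 L9"
proof -
  have solve: "(i, j, k) \<in> L9 \<longleftrightarrow> j = minus9 k i" if "i < 9" "k < 9" for i j k
    using that plus9_eq_iff[of i j k] plus9_eq_iff[of i "minus9 k i" k] minus9_less[of k i]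
    by (auto simp: L9_iff)
  have sym: "(i, j, k) \<in> L9 \<longleftrightarrow> (j, i, k) \<in> L9" for i j k
    using plus9_commute[of i j] by (auto simp: L9_iff)
  have "\<exists>!j. (i, j, k) \<in> L9" if "i < 9" "k < 9" for i k
    using solve[OF that] by simp
  moreover have "\<exists>!i. (i, j, k) \<in> L9" if "j < 9" "k < 9" for j k
    unfolding sym[of _ j] using solve[OF that] by simp
  moreover have "\<exists>!k. (i, j, k) \<in> L9" if "i < 9" "j < 9" for i j
    using that by (simp add: L9_iff)
  moreover have "L9 \<subseteq> {..<9} \<times> {..<9} \<times> {..<9}"
    using plus9_less by (auto simp: L9_iff)
  ultimately show ?thesis
    by (simp add: latin_square_def)
qed

section \<open>The critical set\<close>

text \<open>A triple \<open>(r, c, s)\<close> puts the cell \<open>(r, c)\<close> into the critical set and records a row \<open>s\<close> whose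
  switch with row \<open>r\<close> shows that this cell cannot be omitted.\<close>

definition switches :: "(nat \<times> nat \<times> nat) list" where
  "switches =
    [(0, 1, 1), (0, 5, 7),
     (1, 3, 6), (1, 5, 4), (1, 6, 0),
     (2, 1, 3), (2, 2, 5), (2, 3, 8), (2, 7, 0),
     (3, 0, 2), (3, 2, 8), (3, 3, 5), (3, 7, 4),
     (4, 1, 8), (4, 3, 0), (4, 4, 0),
     (5, 0, 1), (5, 6, 0), (5, 7, 6),
     (6, 1, 8), (6, 4, 1), (6, 5, 4), (6, 6, 0),
     (7, 2, 8), (7, 4, 1), (7, 6, 3), (7, 8, 5),
     (8, 7, 0), (8, 8, 0)]"

definition cells :: "(nat \<times> nat) list" where
  "cells = map (\<lambda>(r, c, s). (r, c)) switches"

definition forcing_order :: "(nat \<times> nat) list" where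
  "forcing_order =
    [(5, 1), (8, 6), (0, 3), (1, 4), (2, 4), (3, 1), (4, 2), (4, 6), (6, 8), (7, 7), (8, 3),
     (0, 6), (0, 7), (1, 1), (3, 6), (4, 7), (6, 7), (8, 1), (0, 2), (1, 7), (2, 0), (2, 6),
     (3, 8), (5, 2), (5, 4), (7, 1), (8, 2), (0, 4), (3, 4), (4, 0), (4, 5), (6, 2), (7, 0),
     (8, 4), (1, 2), (1, 8), (2, 5), (5, 3), (5, 5), (5, 8), (6, 0), (7, 3), (7, 5), (8, 5),
     (0, 0), (0, 8), (1, 0), (2, 8), (3, 5), (4, 8), (6, 3), (8, 0)]"

text \<open>In the table of a group the symbol of a cell determines its position in every row, so the
  known entries are represented by their cells alone: row \<open>x\<close> contains the symbol \<open>i + j\<close> among the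
  known entries iff the cell in column \<open>(i + j) - x\<close> of that row is known.\<close>

fun deduces :: "(nat \<times> nat) list \<Rightarrow> (nat \<times> nat) list \<Rightarrow> bool" where
  "deduces K [] \<longleftrightarrow> True"
| "deduces K ((i, j) # D) \<longleftrightarrow>
     i < 9 \<and> j < 9 \<and>
     list_all (\<lambda>x. x = i \<or> (x, j) \<in> set K \<or> (x, minus9 (plus9 i j) x) \<in> set K) [0..<9] \<and>
     deduces ((i, j) # K) D"

text \<open>A known cell \<open>(x, j)\<close> excludes row \<open>x\<close> because cancellation makes its symbol differ from
  \<open>i + j\<close>; for the same reason, an occurrence of \<open>i + j\<close> in row \<open>x\<close> is in a column other than
  \<open>j\<close>.\<close>

lemma deduces_sound:
  assumes "latin_square 9 M" "entry ` set K \<subseteq> M" "deduces K D"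
  shows "entry ` set (D @ K) \<subseteq> M"
  using assms
proof (induction K D rule: deduces.induct)
  case (1 K)
  then show ?case by simp
next
  case (2 K i j D)
  let ?k = "plus9 i j"
  have j: "j < 9" using 2 by simp
  have K: "(x, y, plus9 x y) \<in> M" if "(x, y) \<in> set K" for x y
    using that 2(3) by (force simp: entry_def)
  have "(i, j, ?k) \<in> M"
  proof (rule forced_entry[OF 2(2) j plus9_less])
    fix x :: nat assume x: "x < 9" "x \<noteq> i"
    let ?y = "minus9 ?k x"
    have i: "i < 9" using 2(4) by simp
    have y: "?y < 9" "plus9 x ?y = ?k"
      using x minus9_less plus9_less plus9_eq_iff[of x ?y ?k] by simp_all
    have neq: "plus9 x j \<noteq> ?k"
      using x i j plus9_less plus9_eq_iff[of j] by (metis plus9_commute)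
    consider "(x, j) \<in> set K" | "(x, ?y) \<in> set K"
      using 2(4) x by (auto simp: list_all_iff)
    then show "(\<exists>k'. k' \<noteq> ?k \<and> (x, j, k') \<in> M) \<or> (\<exists>j'. j' \<noteq> j \<and> (x, j', ?k) \<in> M)"
    proof cases
      case 1
      then show ?thesis using K neq by blast
    next
      case 2
      then show ?thesis using K[of x ?y] y neq by metis
    qed
  qed
  then have "entry ` set ((i, j) # K) \<subseteq> M"
    using 2(3) by (simp add: entry_def)
  then show ?case
    using 2 by simp
qed

lemma uniquely_completable_cells: "uniquely_completable 9 L9 (entry ` set cells)"
proof -
  have ded: "deduces cells forcing_order" by code_simp
  have "list_all (\<lambda>i. list_all (\<lambda>j. (i, j) \<in> set (forcing_order @ cells)) [0..<9]) [0..<9]"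
    by code_simp
  then have full: "(i, j) \<in> set (forcing_order @ cells)" if "i < 9" "j < 9" for i j
    using that by (simp add: list_all_iff)
  have "list_all (\<lambda>(i, j). i < 9 \<and> j < 9) cells" by code_simp
  then have "entry ` set cells \<subseteq> L9"
    by (auto simp: list_all_iff entry_def L9_iff)
  moreover have "M = L9" if M: "latin_square 9 M" "entry ` set cells \<subseteq> M" for M
  proof (rule latin_square_subset_eq[OF latin_square_L9 M(1)])
    have "entry ` set (forcing_order @ cells) \<subseteq> M"
      by (rule deduces_sound[OF M ded])
    then show "L9 \<subseteq> M"
      using full by (force simp: L9_iff entry_def)
  qed
  ultimately show ?thesis
    unfolding uniquely_completable_def using latin_square_L9 by blast
qed

text \<open>The coset \<open>c + \<langle>d\<rangle>\<close> of the subgroup generated by \<open>d\<close>.\<close>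

definition coset :: "nat \<Rightarrow> nat \<Rightarrow> nat list" where
  "coset c d = [c, plus9 c d, plus9 c (plus9 d d)]"

text \<open>The last condition says that \<open>(r, c)\<close> is the only cell of the critical set that the switch
  belonging to it changes.\<close>

lemma switch_checks:
  "list_all (\<lambda>(r, c, s).
     r < 9 \<and> s < 9 \<and> c < 9 \<and> r \<noteq> s \<and>
     set (map (plus9 r) (coset c (minus9 s r))) = set (map (plus9 s) (coset c (minus9 s r))) \<and>
     list_all (\<lambda>(i, j). (i = r \<or> i = s) \<and> j \<in> set (coset c (minus9 s r)) \<longrightarrow> i = r \<and> j = c) cells)
   switches"
  by code_simp

text \<open>The switched square still contains the 28 other entries. It differs from \<open>L9\<close> because the
  cell \<open>(r, c)\<close> now holds the symbol of row \<open>s\<close> in column \<open>c\<close>.\<close>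

lemma other_completion:
  assumes "x \<in> entry ` set cells"
  shows "\<exists>M. latin_square 9 M \<and> entry ` set cells - {x} \<subseteq> M \<and> M \<noteq> L9"
proof -
  obtain r c s where rcs: "(r, c, s) \<in> set switches" and x: "x = entry (r, c)"
    using assms by (auto simp: cells_def)
  define S where "S = set (coset c (minus9 s r))"
  define M where "M = row_switch r s S L9"
  have lt: "r < 9" "s < 9" "c < 9" "r \<noteq> s"
    and img: "plus9 r ` S = plus9 s ` S"
    and only: "\<And>i j. (i, j) \<in> set cells \<Longrightarrow> i = r \<or> i = s \<Longrightarrow> j \<in> S \<Longrightarrow> i = r \<and> j = c"
    using bspec[OF switch_checks[unfolded list_all_iff] rcs] by (auto simp: S_def list_all_iff)
  have S: "j < 9" if "j \<in> S" for j
    using that lt plus9_less by (auto simp: S_def coset_def)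
  have "latin_square 9 M"
    unfolding M_def
  proof (rule latin_square_row_switch[OF latin_square_L9 lt(1,2)])
    fix k
    show "(\<exists>j\<in>S. (r, j, k) \<in> L9) \<longleftrightarrow> (\<exists>j\<in>S. (s, j, k) \<in> L9)"
      using img S lt unfolding L9_iff set_eq_iff image_iff by blast
  qed
  moreover have "entry ` set cells - {x} \<subseteq> M"
  proof
    fix t assume t: "t \<in> entry ` set cells - {x}"
    then obtain i j where ij: "(i, j) \<in> set cells" "t = entry (i, j)" "(i, j) \<noteq> (r, c)"
      using x by auto
    have "t \<in> L9"
      using t uniquely_completable_cells unfolding uniquely_completable_def by blast
    then show "t \<in> M"
      using only[OF ij(1)] ij by (auto simp: M_def row_switch_def entry_def transpose_def)
  qed
  moreover have "M \<noteq> L9"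
  proof -
    have "c \<in> S" by (simp add: S_def coset_def)
    then have "(r, c, plus9 s c) \<in> M"
      using lt by (simp add: M_def row_switch_def L9_iff)
    moreover have "(r, c, plus9 s c) \<notin> L9"
      using lt plus9_less plus9_eq_iff[of c] by (metis L9_iff plus9_commute)
    ultimately show ?thesis by blast
  qed
  ultimately show ?thesis by blast
qed

theorem mainTheorem4:
  shows "\<exists>C. critical_set 9 L9 C \<and> card C = 29"
proof (intro exI conjI)
  show "critical_set 9 L9 (entry ` set cells)"
    by (rule critical_setI[OF uniquely_completable_cells other_completion])
  have "inj entry" by (auto simp: inj_def entry_def)
  moreover have "distinct cells" "length cells = 29" by code_simp+
  ultimately show "card (entry ` set cells) = 29"
    by (metis card_image distinct_card inj_on_subset subset_UNIV)
qed

end
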